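(* Let $X=X_\sigma$, with $\sigma\subseteq N_{\mathbb{R}}$ a nondegenerate cone, be either a three-dimensional terminal $\mathbb{Q}$-factorial singular affine toric variety or a four-dimensional Gorenstein terminal $\mathbb{Q}$-factorial singular affine toric variety. Then $X$ does not admit a moderate toric resolution; that is, there is no moderate toric resolution of $\sigma$.
   Context: Let $M$ and $N$ be free abelian groups of rank $d$ dual to each other, $N_{\mathbb{R}}=N\otimes\mathbb{R}$, $M_{\mathbb{R}}=M\otimes\mathbb{R}$, and $k$ an arbitrary field. A cone in $N_{\mathbb{R}}$ means a strongly convex, rational polyhedral cone. It is nondegenerate if it is $d$-dimensional. For a cone $\sigma$ with dual cone $\sigma^\vee\subseteq M_{\mathbb{R}}$, $X_\sigma=\operatorname{Spec} k[\sigma^\vee\cap M]$; for a fan $\Sigma$, $X_\Sigma$ is the associated toric variety. Each one-dimensional cone $\rho$ contains a unique primitive element $P(\rho)\in\rho\cap N$; $\operatorname{Gen}(\tau)$ denotes the set of the $P(\rho)$ for $\rho$ the one-dimensional faces of a cone $\tau$ (the minimal generators of $\tau$). A cone is smooth if its minimal generators form part of a $\mathbb{Z}$-basis of $N$. A subdivision of $\sigma$ is a (finite) fan whose support is $\sigma$. Properties of $X_\sigma$ in terms of $\sigma$: $X_\sigma$ is singular if and only if $\sigma$ is not smooth; $X_\sigma$ is $\mathbb{Q}$-factorial if and only if $\sigma$ is simplicial (its minimal generators are linearly independent); for simplicial $\sigma$, $X_\sigma$ is terminal if and only if the only elements of $N$ in the convex hull of $\{0\}\cup\operatorname{Gen}(\sigma)$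 are $0$ and the elements of $\operatorname{Gen}(\sigma)$; $X_\sigma$ is Gorenstein if and only if there is $m\in M$ with $\langle m,u\rangle=1$ for all $u\in\operatorname{Gen}(\sigma)$. Moderate toric resolution: a subdivision $\Sigma$ of a nondegenerate cone $\sigma\subseteq N_{\mathbb{R}}$ is a moderate toric resolution of $\sigma$ if every nondegenerate cone $\tau$ of $\Sigma$ is smooth and the affine hyperplane $\{x\in N_{\mathbb{R}}\mid l_\tau(x)=1\}$ spanned by $\operatorname{Gen}(\tau)$ intersects every one-dimensional face of $\sigma$, where $l_\tau:N_{\mathbb{R}}\to\mathbb{R}$ is the linear function sending each minimal generator of $\tau$ to $1$. The induced morphism $X_\Sigma\to X_\sigma$ is also called a moderate toric resolution. *)

theory Defs
  imports "HOL-Analysis.Analysis"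
begin

(* N is realised as a full-rank lattice in the real vector space 'a = N \<otimes> R, so that the rank
   d of N is DIM('a).  The inner product of 'a plays no role. *)

definition lattice_basis :: "'a::euclidean_space set \<Rightarrow> 'a set \<Rightarrow> bool" where
  "lattice_basis N B \<longleftrightarrow> independent B \<and> span B = UNIV \<and>
     N = range (\<lambda>c :: 'a \<Rightarrow> int. \<Sum>b\<in>B. of_int (c b) *\<^sub>R b)"

definition full_lattice :: "'a::euclidean_space set \<Rightarrow> bool" where
  "full_lattice N \<longleftrightarrow> (\<exists>B. lattice_basis N B)"

(* M = Hom(N, Z), each element being extended to an R-linear function on N \<otimes> R; the pairing of
   M and N is evaluation. *)
definition dual_lattice :: "'a::euclidean_space set \<Rightarrow> ('a \<Rightarrow> real) set" where
  "dual_lattice N = {m. linear m \<and> (\<forall>u\<in>N. m u \<in> \<int>)}"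

definition rational_cone :: "'a::euclidean_space set \<Rightarrow> 'a set \<Rightarrow> bool" where
  "rational_cone N \<sigma> \<longleftrightarrow>
     (\<exists>S. finite S \<and> S \<subseteq> N \<and> \<sigma> = convex_cone hull S) \<and> \<sigma> \<inter> uminus ` \<sigma> = {0}"

definition nondegenerate_cone :: "'a::euclidean_space set \<Rightarrow> 'a set \<Rightarrow> bool" where
  "nondegenerate_cone N \<sigma> \<longleftrightarrow> rational_cone N \<sigma> \<and> dim \<sigma> = DIM('a)"

(* The library relation face_of also counts the empty set as a face. *)
definition cone_faces :: "'a::euclidean_space set \<Rightarrow> 'a set set" where
  "cone_faces \<sigma> = {\<tau>. \<tau> face_of \<sigma> \<and> \<tau> \<noteq> {}}"

definition rays :: "'a::euclidean_space set \<Rightarrow> 'a set set" where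
  "rays \<sigma> = {\<rho> \<in> cone_faces \<sigma>. dim \<rho> = 1}"

definition primitive :: "'a::euclidean_space set \<Rightarrow> 'a \<Rightarrow> bool" where
  "primitive N u \<longleftrightarrow> u \<in> N \<and> u \<noteq> 0 \<and> (\<forall>v\<in>N. \<forall>k::int. u = of_int k *\<^sub>R v \<longrightarrow> \<bar>k\<bar> = 1)"

(* The set of the P(\<rho>): a ray of a strongly convex rational cone contains exactly one
   primitive element. *)
definition Gen :: "'a::euclidean_space set \<Rightarrow> 'a set \<Rightarrow> 'a set" where
  "Gen N \<tau> = {u. primitive N u \<and> (\<exists>\<rho>\<in>rays \<tau>. u \<in> \<rho>)}"

definition smooth_cone :: "'a::euclidean_space set \<Rightarrow> 'a set \<Rightarrow> bool" where
  "smooth_cone N \<tau> \<longleftrightarrow> (\<exists>B. lattice_basis N B \<and> Gen N \<tau> \<subseteq> B)"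

definition fan :: "'a::euclidean_space set \<Rightarrow> 'a set set \<Rightarrow> bool" where
  "fan N \<Sigma> \<longleftrightarrow> finite \<Sigma> \<and> (\<forall>\<tau>\<in>\<Sigma>. rational_cone N \<tau> \<and> cone_faces \<tau> \<subseteq> \<Sigma>) \<and>
     (\<forall>\<tau>\<in>\<Sigma>. \<forall>\<tau>'\<in>\<Sigma>. \<tau> \<inter> \<tau>' \<in> cone_faces \<tau> \<and> \<tau> \<inter> \<tau>' \<in> cone_faces \<tau>')"

definition subdivision :: "'a::euclidean_space set \<Rightarrow> 'a set \<Rightarrow> 'a set set \<Rightarrow> bool" where
  "subdivision N \<sigma> \<Sigma> \<longleftrightarrow> fan N \<Sigma> \<and> \<Union>\<Sigma> = \<sigma>"

(* Since Gen N \<tau> is a basis of the vector space for smooth nondegenerate \<tau>, the function l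
   below is the unique l_\<tau>. *)
definition moderate_toric_resolution ::
    "'a::euclidean_space set \<Rightarrow> 'a set \<Rightarrow> 'a set set \<Rightarrow> bool" where
  "moderate_toric_resolution N \<sigma> \<Sigma> \<longleftrightarrow>
     nondegenerate_cone N \<sigma> \<and> subdivision N \<sigma> \<Sigma> \<and>
     (\<forall>\<tau>\<in>\<Sigma>. nondegenerate_cone N \<tau> \<longrightarrow>
        smooth_cone N \<tau> \<and>
        (\<exists>l :: 'a \<Rightarrow> real. linear l \<and> (\<forall>u\<in>Gen N \<tau>. l u = 1) \<and>
           (\<forall>\<rho>\<in>rays \<sigma>. {x. l x = 1} \<inter> \<rho> \<noteq> {})))"

(* Properties of the affine toric variety X_\<sigma> = Spec k[\<sigma>^\<or> \<inter> M], each expressed by the standard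
   equivalent condition on \<sigma>, which does not depend on the field k. *)

definition toric_singular :: "'a::euclidean_space set \<Rightarrow> 'a set \<Rightarrow> bool" where
  "toric_singular N \<sigma> \<longleftrightarrow> \<not> smooth_cone N \<sigma>"

definition toric_Q_factorial :: "'a::euclidean_space set \<Rightarrow> 'a set \<Rightarrow> bool" where
  "toric_Q_factorial N \<sigma> \<longleftrightarrow> independent (Gen N \<sigma>)"

(* The criterion for simplicial \<sigma>; only to be used together with toric_Q_factorial. *)
definition toric_terminal :: "'a::euclidean_space set \<Rightarrow> 'a set \<Rightarrow> bool" where
  "toric_terminal N \<sigma> \<longleftrightarrow> N \<inter> convex hull (insert 0 (Gen N \<sigma>)) = insert 0 (Gen N \<sigma>)"

definition toric_Gorenstein :: "'a::euclidean_space set \<Rightarrow> 'a set \<Rightarrow> bool" where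
  "toric_Gorenstein N \<sigma> \<longleftrightarrow> (\<exists>m\<in>dual_lattice N. \<forall>u\<in>Gen N \<sigma>. m u = 1)"

end

theory Submission
  imports Defs
begin

text \<open>
  A moderate toric resolution of a terminal simplicial cone \<open>\<sigma>\<close> can use no rays except those
  of \<open>\<sigma>\<close> itself, which is absurd if \<open>\<sigma>\<close> is singular.  Let \<open>\<tau>\<close> be a nondegenerate cone of such a
  resolution.  As \<open>\<tau>\<close> is smooth, its minimal generators form a basis of \<open>N\<close>, so \<open>l\<^sub>\<tau>\<close> takes integer
  values on \<open>N\<close>; as the hyperplane \<open>l\<^sub>\<tau> = 1\<close> meets every ray of \<open>\<sigma>\<close>, it is positive on \<open>Gen \<sigma>\<close>.
  Hence \<open>l\<^sub>\<tau> \<ge> 1\<close> on \<open>Gen \<sigma>\<close> (\<open>moderate_form_ge_1\<close>).  Writing a minimal generator \<open>u\<close> of \<open>\<tau>\<close>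
  as a combination of \<open>Gen \<sigma>\<close> with nonnegative coefficients, the equation \<open>l\<^sub>\<tau> u = 1\<close> forces the
  sum of the coefficients to be at most 1, so \<open>u\<close> is a lattice point of the convex hull of \<open>0\<close>
  and \<open>Gen \<sigma>\<close> (\<open>low_points_in_hull\<close>).  Terminality gives \<open>u \<in> Gen \<sigma>\<close>.  So \<open>Gen \<tau> \<subseteq> Gen \<sigma>\<close>; the
  left-hand side spans the space and the right-hand side is independent, so both are equal and
  \<open>\<sigma>\<close> is smooth.

  Two facts from the theory of cones are behind this.  A strongly convex rational cone is
  generated by the primitive vectors on its rays (\<open>rational_cone_eq_hull_Gen\<close>), and a
  subdivision of a nondegenerate cone contains a nondegenerate cone
  (\<open>subdivision_has_nondegenerate\<close>), since finitely many lower-dimensional cones have measure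
  zero.
\<close>

section \<open>Lattices\<close>

lemma lattice_uminus:
  assumes "full_lattice N" "v \<in> N"
  shows "- v \<in> N"
proof -
  obtain B where N: "N = range (\<lambda>c :: 'a \<Rightarrow> int. \<Sum>b\<in>B. of_int (c b) *\<^sub>R b)"
    using assms unfolding full_lattice_def lattice_basis_def by blast
  obtain c :: "'a \<Rightarrow> int" where v: "v = (\<Sum>b\<in>B. of_int (c b) *\<^sub>R b)"
    using assms(2) unfolding N by blast
  have "- v = (\<Sum>b\<in>B. of_int ((\<lambda>b. - c b) b) *\<^sub>R b)"
    unfolding v by (simp add: sum_negf)
  then show ?thesis unfolding N by (rule range_eqI[where x = "\<lambda>b. - c b"])
qed

lemma primitive_uminus:
  assumes "full_lattice N" "primitive N u"
  shows "primitive N (- u)"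
  unfolding primitive_def
proof (intro conjI ballI allI impI)
  show "- u \<in> N" "- u \<noteq> 0"
    using assms lattice_uminus unfolding primitive_def by auto
  fix v and k :: int
  assume "v \<in> N" and k: "- u = of_int k *\<^sub>R v"
  have "u = of_int k *\<^sub>R (- v)"
    using k by (metis minus_minus scaleR_minus_right)
  then show "\<bar>k\<bar> = 1"
    using assms \<open>v \<in> N\<close> lattice_uminus unfolding primitive_def by blast
qed

text \<open>Dividing a lattice vector by an integer other than \<open>0\<close> and \<open>\<plusminus>1\<close> shrinks the absolute value
  of each nonzero coordinate, so induction on one such coordinate reaches a primitive vector.\<close>

lemma ex_primitive_multiple:
  assumes N: "full_lattice N" and "s \<in> N" "s \<noteq> 0"
  shows "\<exists>u t. primitive N u \<and> t > 0 \<and> s = t *\<^sub>R u"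
proof -
  obtain B where ind: "independent B"
    and NB: "N = range (\<lambda>c :: 'a \<Rightarrow> int. \<Sum>b\<in>B. of_int (c b) *\<^sub>R b)"
    using N unfolding full_lattice_def lattice_basis_def by blast
  obtain c :: "'a \<Rightarrow> int" where s: "s = (\<Sum>b\<in>B. of_int (c b) *\<^sub>R b)"
    using \<open>s \<in> N\<close> unfolding NB by blast
  have "\<exists>b\<in>B. c b \<noteq> 0"
    using s \<open>s \<noteq> 0\<close> by (metis (no_types, lifting) of_int_0 scale_eq_0_iff sum.neutral)
  then obtain b where b: "b \<in> B" "c b \<noteq> 0" by blast
  (* A coordinate that is nonzero on s; being integral on N, it serves as induction measure. *)
  define f where "f x = representation B x b" for x
  have fB: "f (\<Sum>b\<in>B. of_int (d b) *\<^sub>R b) = of_int (d b)" for d :: "'a \<Rightarrow> int"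
  proof -
    have "representation B (\<Sum>b\<in>B. of_int (d b) *\<^sub>R b) =
        (\<lambda>x. if x \<in> B then of_int (d x) else (0::real))"
    proof (rule representation_eqI[OF ind])
      show "(\<Sum>b\<in>B. of_int (d b) *\<^sub>R b) \<in> span B"
        by (intro span_sum span_scale span_base)
      show "finite {x. (if x \<in> B then of_int (d x) else (0::real)) \<noteq> 0}"
        using independent_imp_finite[OF ind] by (rule finite_subset[rotated]) auto
      have "(\<Sum>x\<in>B. (if x \<in> B then of_int (d x) else 0) *\<^sub>R x)
          = (\<Sum>x\<in>{x. (if x \<in> B then of_int (d x) else (0::real)) \<noteq> 0}.
              (if x \<in> B then of_int (d x) else 0) *\<^sub>R x)"
        by (rule sum.mono_neutral_right[OF independent_imp_finite[OF ind]]) auto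
      then show "(\<Sum>x\<in>{x. (if x \<in> B then of_int (d x) else (0::real)) \<noteq> 0}.
              (if x \<in> B then of_int (d x) else 0) *\<^sub>R x) = (\<Sum>b\<in>B. of_int (d b) *\<^sub>R b)"
        by simp
    qed (auto split: if_splits)
    then show ?thesis unfolding f_def using b by simp
  qed
  have f_int: "\<exists>m::int. f x = of_int m" if "x \<in> N" for x
    using that fB unfolding NB by blast
  have f_scale: "f (r *\<^sub>R x) = r * f x" if "x \<in> N" for r x
  proof -
    obtain d :: "'a \<Rightarrow> int" where "x = (\<Sum>b\<in>B. of_int (d b) *\<^sub>R b)"
      using \<open>x \<in> N\<close> unfolding NB by blast
    then have "x \<in> span B"
      by (simp only:) (intro span_sum span_scale span_base)
    then show ?thesis
      unfolding f_def using representation_scale[OF ind] by simp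
  qed
  have *: "\<exists>u t. primitive N u \<and> t > 0 \<and> x = t *\<^sub>R u"
    if "x \<in> N" "f x \<noteq> 0" for x
    using that
  proof (induction "nat \<lfloor>\<bar>f x\<bar>\<rfloor>" arbitrary: x rule: less_induct)
    case less
    show ?case
    proof (cases "primitive N x")
      case True
      then show ?thesis by (intro exI[of _ x] exI[of _ 1]) auto
    next
      case False
      have "f 0 = 0" unfolding f_def by (simp add: representation_zero)
      then have "x \<noteq> 0" using less.prems by auto
      then obtain v and k :: int where v: "v \<in> N" "x = of_int k *\<^sub>R v" "\<bar>k\<bar> \<noteq> 1"
        using False less.prems unfolding primitive_def by blast
      have fx: "f x = of_int k * f v" using f_scale v by simp
      have k: "\<bar>k\<bar> \<ge> 2" using v(3) \<open>x \<noteq> 0\<close> v(2) by (cases "k = 0") auto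
      obtain m where m: "f v = of_int m" using f_int v by blast
      have "m \<noteq> 0" using fx less.prems m by auto
      have "\<bar>k * m\<bar> > \<bar>m\<bar>"
        using k \<open>m \<noteq> 0\<close> by (simp add: abs_mult)
      then have "nat \<lfloor>\<bar>f v\<bar>\<rfloor> < nat \<lfloor>\<bar>f x\<bar>\<rfloor>"
        unfolding fx m by (simp only: floor_of_int flip: of_int_mult of_int_abs)
      moreover have "f v \<noteq> 0" using m \<open>m \<noteq> 0\<close> by simp
      ultimately obtain u t where u: "primitive N u" "t > 0" "v = t *\<^sub>R u"
        using less.hyps v(1) by blast
      show ?thesis
      proof (cases "k > 0")
        case True
        then show ?thesis
          using u v(2) by (intro exI[of _ u] exI[of _ "of_int k * t"]) auto
      next
        case False
        then show ?thesis
          using u v(2) k primitive_uminus[OF N]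
          by (intro exI[of _ "- u"] exI[of _ "- of_int k * t"]) (auto intro!: mult_neg_pos)
      qed
    qed
  qed
  show ?thesis
    by (rule *) (use \<open>s \<in> N\<close> b fB[of c] s in auto)
qed

section \<open>Strongly convex rational cones\<close>

lemma rational_cone_convex_cone: "rational_cone N \<sigma> \<Longrightarrow> convex_cone \<sigma>"
  unfolding rational_cone_def using convex_cone_convex_cone_hull by blast

lemma rational_cone_pointed:
  assumes "rational_cone N \<sigma>" "x \<in> \<sigma>" "- x \<in> \<sigma>"
  shows "x = 0"
proof -
  have "x \<in> \<sigma> \<inter> uminus ` \<sigma>"
    using assms by (metis IntI add.inverse_inverse imageI)
  then show ?thesis using assms(1) unfolding rational_cone_def by blast
qed

lemma convex_cone_hull_insertE:
  assumes "x \<in> convex_cone hull (insert s T)"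
  obtains a y where "a \<ge> 0" "y \<in> convex_cone hull T" "x = a *\<^sub>R s + y"
proof -
  have "convex_cone {a *\<^sub>R s |a. a \<ge> 0}"
    unfolding convex_cone_iff
  proof (intro conjI ballI allI impI)
    show "0 \<in> {a *\<^sub>R s |a. a \<ge> 0}" by force
  next
    fix x y assume "x \<in> {a *\<^sub>R s |a. a \<ge> 0}" "y \<in> {a *\<^sub>R s |a. a \<ge> 0}"
    then obtain a b where "a \<ge> 0" "b \<ge> 0" "x = a *\<^sub>R s" "y = b *\<^sub>R s" by blast
    then show "x + y \<in> {a *\<^sub>R s |a. a \<ge> 0}"
      by (intro CollectI exI[of _ "a + b"]) (simp add: scaleR_add_left)
  next
    fix x c assume "x \<in> {a *\<^sub>R s |a. a \<ge> 0}" "(c::real) \<ge> 0"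
    then obtain a where "a \<ge> 0" "x = a *\<^sub>R s" by blast
    then show "c *\<^sub>R x \<in> {a *\<^sub>R s |a. a \<ge> 0}"
      using \<open>c \<ge> 0\<close> by (intro CollectI exI[of _ "c * a"]) simp
  qed
  moreover have "s = 1 *\<^sub>R s" by simp
  then have "{s} \<subseteq> {a *\<^sub>R s |a. a \<ge> 0}" by fastforce
  ultimately have "convex_cone hull {s} \<subseteq> {a *\<^sub>R s |a. a \<ge> 0}"
    by (intro hull_minimal)
  moreover have "x \<in> (\<Union>p \<in> convex_cone hull {s}. \<Union>y \<in> convex_cone hull T. {p + y})"
    using assms convex_cone_hull_Un[of "{s}" T] by simp
  ultimately show ?thesis using that by blast
qed

text \<open>If two points of the cone add up to a multiple of \<open>s\<close>, compare coefficients of \<open>s\<close>: as \<open>s\<close>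
  is not generated by \<open>T\<close>, the two coefficients already exhaust the multiple, so the contributions
  of \<open>T\<close> and a nonnegative multiple of \<open>s\<close> sum to zero.  By pointedness these contributions vanish,
  which puts both points on the ray.\<close>

lemma irredundant_generator_ray:
  assumes rc: "rational_cone N \<sigma>" and hull: "\<sigma> = convex_cone hull (insert s T)"
    and irr: "s \<notin> convex_cone hull T"
  shows "{a *\<^sub>R s |a. a \<ge> 0} \<in> rays \<sigma>"
proof -
  let ?R = "{a *\<^sub>R s |a. a \<ge> 0}"
  have cc: "convex_cone \<sigma>" using rc by (rule rational_cone_convex_cone)
  have s: "s \<in> \<sigma>" "s \<noteq> 0"
    using irr convex_cone_hull_contains_0 unfolding hull by (auto intro: hull_inc)
  have T: "convex_cone hull T \<subseteq> \<sigma>" unfolding hull by (rule hull_mono) auto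
  have sum0: "x = 0" if "x \<in> \<sigma>" "y \<in> \<sigma>" "x + y = 0" for x y
    using rational_cone_pointed[OF rc, of x] that by (metis add_eq_0_iff)
  have add_mem: "p \<in> ?R" if p: "p \<in> \<sigma>" and q: "q \<in> \<sigma>" and pq: "p + q \<in> ?R" for p q
  proof -
    obtain a x where a: "a \<ge> 0" "x \<in> convex_cone hull T" "p = a *\<^sub>R s + x"
      using p unfolding hull by (rule convex_cone_hull_insertE)
    obtain b y where b: "b \<ge> 0" "y \<in> convex_cone hull T" "q = b *\<^sub>R s + y"
      using q unfolding hull by (rule convex_cone_hull_insertE)
    obtain c where c: "p + q = c *\<^sub>R s" using pq by blast
    have eq: "(c - a - b) *\<^sub>R s = x + y"
      using c a(3) b(3) by (simp add: algebra_simps)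
    have xy: "x + y \<in> convex_cone hull T" using a b convex_cone_hull_add by blast
    have "c - a - b \<le> 0"
    proof (rule ccontr)
      assume pos: "\<not> c - a - b \<le> 0"
      have "s = inverse (c - a - b) *\<^sub>R ((c - a - b) *\<^sub>R s)" using pos by simp
      also have "\<dots> = inverse (c - a - b) *\<^sub>R (x + y)" using eq by simp
      also have "\<dots> \<in> convex_cone hull T"
        using pos by (intro convex_cone_hull_mul xy) simp
      finally show False using irr by simp
    qed
    then have "y + (a + b - c) *\<^sub>R s \<in> \<sigma>"
      using b T s by (intro convex_cone_add[OF cc] convex_cone_scaleR[OF cc]) auto
    moreover have "x + (y + (a + b - c) *\<^sub>R s) = 0"
      using eq by (simp add: algebra_simps)
    ultimately have "x = 0" using sum0 a T by blast
    then show ?thesis using a by auto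
  qed
  have unscale: "p \<in> ?R" if r: "r *\<^sub>R p \<in> ?R" "r > 0" for r p
  proof -
    obtain a where a: "a \<ge> 0" "r *\<^sub>R p = a *\<^sub>R s" using r(1) by blast
    have "p = inverse r *\<^sub>R (r *\<^sub>R p)" using \<open>r > 0\<close> by simp
    also have "\<dots> = (a / r) *\<^sub>R s" unfolding a(2) by (simp add: divide_inverse_commute)
    finally have "p = (a / r) *\<^sub>R s" .
    then show ?thesis using a \<open>r > 0\<close> by (intro CollectI exI[of _ "a / r"]) simp
  qed
  have "?R face_of \<sigma>"
    unfolding face_of_def
  proof (intro conjI ballI impI)
    show "?R \<subseteq> \<sigma>" using s convex_cone_scaleR[OF cc] by blast
    show "convex ?R"
    proof (rule convexI)
      fix x y and u v :: real
      assume "x \<in> ?R" "y \<in> ?R" "u \<ge> 0" "v \<ge> 0"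
      then obtain a b where "a \<ge> 0" "b \<ge> 0" "x = a *\<^sub>R s" "y = b *\<^sub>R s" by blast
      then show "u *\<^sub>R x + v *\<^sub>R y \<in> ?R"
        using \<open>u \<ge> 0\<close> \<open>v \<ge> 0\<close>
        by (intro CollectI exI[of _ "u * a + v * b"]) (simp add: scaleR_add_left)
    qed
  next
    fix a b x assume ab: "a \<in> \<sigma>" "b \<in> \<sigma>" "x \<in> ?R" "x \<in> open_segment a b"
    then obtain u where u: "0 < u" "u < 1" "x = (1 - u) *\<^sub>R a + u *\<^sub>R b"
      unfolding in_segment by blast
    have 1: "(1 - u) *\<^sub>R a \<in> \<sigma>" "u *\<^sub>R b \<in> \<sigma>"
      using ab u convex_cone_scaleR[OF cc] by simp_all
    have "(1 - u) *\<^sub>R a \<in> ?R" by (rule add_mem[OF 1]) (use ab u in simp)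
    then show "a \<in> ?R" by (rule unscale) (use u in simp)
    have "u *\<^sub>R b \<in> ?R"
      by (rule add_mem[OF 1(2) 1(1)]) (use ab(3) u in \<open>simp add: add.commute\<close>)
    then show "b \<in> ?R" by (rule unscale) (use u in simp)
  qed
  moreover have "s \<in> ?R" by (intro CollectI exI[of _ 1]) simp
  moreover have "dim ?R = 1"
  proof -
    have "dim {s} = dim ?R"
    proof (rule span_eq_dim)
      show "span {s} = span ?R"
      proof
        show "span {s} \<subseteq> span ?R" using \<open>s \<in> ?R\<close> by (intro span_mono) blast
        show "span ?R \<subseteq> span {s}"
          by (rule span_minimal) (auto intro: span_scale span_base)
      qed
    qed
    moreover have "dim {s} = 1" using s(2) by (simp add: dim_insert)
    ultimately show ?thesis by simp
  qed
  ultimately show ?thesis unfolding rays_def cone_faces_def by blast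
qed

lemma Gen_subset: "Gen N \<sigma> \<subseteq> \<sigma>"
  unfolding Gen_def rays_def cone_faces_def using face_of_imp_subset by blast

text \<open>Among the finite sets of lattice vectors generating the cone, one of least cardinality is
  irredundant, so its members are positive multiples of minimal generators.\<close>

proposition rational_cone_eq_hull_Gen:
  assumes N: "full_lattice N" and rc: "rational_cone N \<sigma>"
  shows "\<sigma> = convex_cone hull (Gen N \<sigma>)"
proof
  let ?P = "\<lambda>S. finite S \<and> S \<subseteq> N \<and> \<sigma> = convex_cone hull S"
  obtain S0 where "?P S0" using rc unfolding rational_cone_def by blast
  then obtain S where S: "?P S" and least: "\<And>S'. ?P S' \<Longrightarrow> card S \<le> card S'"
    using ex_has_least_nat[of ?P S0 card] by blast
  have "s \<in> convex_cone hull (Gen N \<sigma>)" if s: "s \<in> S" for s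
  proof -
    let ?T = "S - {s}"
    have hullS: "\<sigma> = convex_cone hull (insert s ?T)"
      using S s by (simp add: insert_absorb)
    have irr: "s \<notin> convex_cone hull ?T"
    proof
      assume *: "s \<in> convex_cone hull ?T"
      have "convex_cone hull (insert s ?T) = convex_cone hull ?T"
        using * by (rule hull_redundant)
      then have "?P ?T" using S hullS by auto
      then have "card S \<le> card ?T" by (rule least)
      moreover have "card ?T < card S" using S s by (intro card_Diff1_less) auto
      ultimately show False by simp
    qed
    have ray: "{a *\<^sub>R s |a. a \<ge> 0} \<in> rays \<sigma>"
      using irredundant_generator_ray[OF rc hullS irr] .
    have "s \<in> N" "s \<noteq> 0"
      using S s irr convex_cone_hull_contains_0[of ?T] by auto
    then obtain u t where u: "primitive N u" "t > 0" "s = t *\<^sub>R u"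
      using ex_primitive_multiple[OF N] by blast
    have "u = inverse t *\<^sub>R s" using u by simp
    then have "u \<in> {a *\<^sub>R s |a. a \<ge> 0}"
      using \<open>t > 0\<close> by (intro CollectI exI[of _ "inverse t"]) simp
    then have "u \<in> Gen N \<sigma>" using u(1) bexI[OF _ ray] unfolding Gen_def by simp
    then show ?thesis using u(2,3) by (simp add: hull_inc convex_cone_hull_mul)
  qed
  then have "convex_cone hull S \<subseteq> convex_cone hull (Gen N \<sigma>)"
    by (intro hull_minimal convex_cone_convex_cone_hull) blast
  then show "\<sigma> \<subseteq> convex_cone hull (Gen N \<sigma>)" using S by simp
  show "convex_cone hull (Gen N \<sigma>) \<subseteq> \<sigma>"
    using Gen_subset rational_cone_convex_cone[OF rc] by (rule hull_minimal)
qed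

lemma nondegenerate_span_Gen:
  assumes "full_lattice N" "nondegenerate_cone N \<sigma>"
  shows "span (Gen N \<sigma>) = UNIV"
proof -
  have "\<sigma> \<subseteq> span (Gen N \<sigma>)"
    using rational_cone_eq_hull_Gen[OF assms(1)] assms(2)
    unfolding nondegenerate_cone_def
    by (metis convex_cone_span hull_minimal span_superset)
  then have "dim \<sigma> \<le> dim (Gen N \<sigma>)" by (metis dim_span dim_subset)
  then have "dim (Gen N \<sigma>) = DIM('a)"
    using assms(2) dim_subset_UNIV[of "Gen N \<sigma>"] unfolding nondegenerate_cone_def by simp
  then show ?thesis using dim_eq_full by blast
qed

lemma subdivision_has_nondegenerate:
  fixes N \<sigma> :: "'a::euclidean_space set"
  assumes \<sigma>: "nondegenerate_cone N \<sigma>" and sub: "subdivision N \<sigma> \<Sigma>"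
  obtains \<tau> where "\<tau> \<in> \<Sigma>" "nondegenerate_cone N \<tau>" "\<tau> \<subseteq> \<sigma>"
proof -
  have fan: "finite \<Sigma>" "\<And>\<tau>. \<tau> \<in> \<Sigma> \<Longrightarrow> rational_cone N \<tau>" and un: "\<Union>\<Sigma> = \<sigma>"
    using sub unfolding subdivision_def fan_def by auto
  have cc: "convex_cone \<sigma>"
    using \<sigma> rational_cone_convex_cone unfolding nondegenerate_cone_def by blast
  have "\<not> negligible \<sigma>"
  proof
    assume "negligible \<sigma>"
    then have "interior \<sigma> = {}" using cc unfolding convex_cone_def by (simp add: negligible_convex_interior)
    then obtain a b where ab: "a \<noteq> 0" "\<sigma> \<subseteq> {x. a \<bullet> x = b}"
      using empty_interior_subset_hyperplane cc unfolding convex_cone_def by metis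
    have "b = 0" using ab(2) convex_cone_contains_0[OF cc] by auto
    then have "dim \<sigma> \<le> dim {x. a \<bullet> x = 0}" using ab by (intro dim_subset) simp
    also have "\<dots> < DIM('a)" using ab by (simp add: dim_hyperplane)
    finally show False using \<sigma> unfolding nondegenerate_cone_def by simp
  qed
  then obtain \<tau> where \<tau>: "\<tau> \<in> \<Sigma>" "\<not> negligible \<tau>"
    using fan(1) un negligible_Union by blast
  then have "\<not> dim \<tau> < DIM('a)" using negligible_lowdim by blast
  then have "dim \<tau> = DIM('a)" using dim_subset_UNIV[of \<tau>] by simp
  then show ?thesis
    using that \<tau> fan(2) un unfolding nondegenerate_cone_def by blast
qed

section \<open>Moderate resolutions of terminal cones\<close>

lemma smooth_nondegenerate_lattice_basis:
  assumes "full_lattice N" "nondegenerate_cone N \<tau>" "smooth_cone N \<tau>"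
  shows "lattice_basis N (Gen N \<tau>)"
proof -
  obtain B where B: "lattice_basis N B" "Gen N \<tau> \<subseteq> B"
    using assms(3) unfolding smooth_cone_def by blast
  have "B \<subseteq> Gen N \<tau>"
  proof
    fix b assume "b \<in> B"
    show "b \<in> Gen N \<tau>"
    proof (rule ccontr)
      assume "b \<notin> Gen N \<tau>"
      then have "span (Gen N \<tau>) \<subseteq> span (B - {b})" using B(2) by (intro span_mono) blast
      then show False
        using nondegenerate_span_Gen[OF assms(1,2)] B(1) \<open>b \<in> B\<close>
        unfolding lattice_basis_def dependent_def by blast
    qed
  qed
  then show ?thesis using B by (metis subset_antisym)
qed

lemma linear_1_on_basis_integral:
  assumes B: "lattice_basis N B" and l: "linear l" "\<And>u. u \<in> B \<Longrightarrow> l u = (1::real)" and "v \<in> N"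
  shows "l v \<in> \<int>"
proof -
  obtain c :: "'a \<Rightarrow> int" where v: "v = (\<Sum>b\<in>B. of_int (c b) *\<^sub>R b)"
    using B \<open>v \<in> N\<close> unfolding lattice_basis_def by blast
  have "l v = (\<Sum>b\<in>B. of_int (c b) * l b)"
    unfolding v using l(1) by (simp add: linear_sum linear_scale)
  also have "\<dots> = of_int (\<Sum>b\<in>B. c b)" using l(2) by simp
  finally show ?thesis by (simp only: Ints_of_int)
qed

text \<open>Integrality turns positivity on the rays into a lower bound by 1 at their primitive
  vectors.\<close>

lemma moderate_form_ge_1:
  assumes rc: "rational_cone N \<sigma>" and l: "linear l"
    and int: "\<And>v. v \<in> N \<Longrightarrow> l v \<in> \<int>"
    and meet: "\<And>\<rho>. \<rho> \<in> rays \<sigma> \<Longrightarrow> {x. l x = (1::real)} \<inter> \<rho> \<noteq> {}"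
    and v: "v \<in> Gen N \<sigma>"
  shows "l v \<ge> 1"
proof -
  obtain \<rho> where prim: "primitive N v" and \<rho>: "\<rho> \<in> rays \<sigma>" "v \<in> \<rho>"
    using v unfolding Gen_def by blast
  obtain w where w: "l w = 1" "w \<in> \<rho>" using meet[OF \<rho>(1)] by blast
  have v0: "v \<noteq> 0" "v \<in> N" using prim unfolding primitive_def by auto
  have \<rho>': "\<rho> \<subseteq> \<sigma>" "dim \<rho> = 1"
    using \<rho> face_of_imp_subset unfolding rays_def cone_faces_def by auto
  have "\<rho> \<subseteq> span {v}"
  proof (rule card_ge_dim_independent)
    show "{v} \<subseteq> \<rho>" using \<rho> by simp
    show "independent {v}" using v0 by simp
    show "dim \<rho> \<le> card {v}" using \<rho>' by simp
  qed
  then obtain c where c: "w = c *\<^sub>R v"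
    using w by (auto simp: span_singleton)
  have cl: "c * l v = 1" using w(1) c l by (simp add: linear_scale)
  have cc: "convex_cone \<sigma>" using rc by (rule rational_cone_convex_cone)
  have "c > 0"
  proof (rule ccontr)
    assume "\<not> c > 0"
    moreover have "c \<noteq> 0" using cl by auto
    ultimately have c0: "c < 0" by simp
    have "(- inverse c) *\<^sub>R w \<in> \<sigma>"
      using c0 w \<rho>' by (intro convex_cone_scaleR[OF cc]) auto
    then have "- v \<in> \<sigma>" using c c0 by simp
    then show False
      using rational_cone_pointed[OF rc, of v] v0 \<rho> \<rho>' by blast
  qed
  then have "l v > 0" using cl by (metis zero_less_mult_pos zero_less_one)
  moreover obtain k where "l v = of_int k" using int[OF v0(2)] by (auto elim: Ints_cases)
  ultimately show ?thesis by simp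
qed

lemma low_points_in_hull:
  assumes l: "linear l" and ge: "\<And>v. v \<in> G \<Longrightarrow> l v \<ge> (1::real)"
    and x: "x \<in> convex_cone hull G" and le: "l x \<le> 1"
  shows "x \<in> convex hull (insert 0 G)"
proof -
  let ?H = "convex hull (insert 0 G)"
  \<comment> \<open>\<open>t\<close> stands for the sum of the coefficients of \<open>x\<close> in terms of \<open>G\<close>,
    which the bound on \<open>l\<close> keeps below \<open>l x\<close>.\<close>
  let ?K = "{x. \<exists>t y. t \<ge> 0 \<and> t \<le> l x \<and> y \<in> ?H \<and> x = t *\<^sub>R y}"
  have zero: "0 \<in> ?K"
    using l by (auto simp: linear_0 intro!: exI[of _ 0] hull_inc)
  have "convex_cone ?K"
    unfolding convex_cone_iff
  proof (intro conjI ballI allI impI)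
    show "0 \<in> ?K" by (rule zero)
  next
    fix p q assume "p \<in> ?K" "q \<in> ?K"
    then obtain a y b z where a: "a \<ge> 0" "a \<le> l p" "y \<in> ?H" "p = a *\<^sub>R y"
      and b: "b \<ge> 0" "b \<le> l q" "z \<in> ?H" "q = b *\<^sub>R z" by blast
    show "p + q \<in> ?K"
    proof (cases "a + b = 0")
      case True
      then have "p + q = 0" using a b by (simp add: add_nonneg_eq_0_iff)
      then show ?thesis using zero by simp
    next
      case False
      then have pos: "a + b > 0" using a b by simp
      have "(a / (a + b)) *\<^sub>R y + (b / (a + b)) *\<^sub>R z \<in> ?H"
        using a b pos
        by (intro convexD[OF convex_convex_hull]) (auto simp: add_divide_distrib[symmetric])
      moreover have "p + q = (a + b) *\<^sub>R ((a / (a + b)) *\<^sub>R y + (b / (a + b)) *\<^sub>R z)"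
        using a b pos by (simp add: scaleR_add_right)
      moreover have "a + b \<le> l (p + q)" using a b l by (simp add: linear_add)
      ultimately show ?thesis using pos less_imp_le by blast
    qed
  next
    fix p and c :: real assume "p \<in> ?K" "c \<ge> 0"
    then obtain a y where a: "a \<ge> 0" "a \<le> l p" "y \<in> ?H" "p = a *\<^sub>R y" by blast
    have "c * a \<le> l (c *\<^sub>R p)"
      using mult_left_mono[OF a(2) \<open>c \<ge> 0\<close>] l by (simp add: linear_scale)
    then show "c *\<^sub>R p \<in> ?K"
      using a \<open>c \<ge> 0\<close> by (intro CollectI exI[of _ "c * a"] exI[of _ y]) simp
  qed
  moreover have "G \<subseteq> ?K"
  proof
    fix v assume "v \<in> G"
    then show "v \<in> ?K"
      using ge by (intro CollectI exI[of _ 1] exI[of _ v]) (auto intro: hull_inc)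
  qed
  ultimately have "convex_cone hull G \<subseteq> ?K" by (intro hull_minimal)
  then obtain t y where t: "t \<ge> 0" "t \<le> l x" "y \<in> ?H" "x = t *\<^sub>R y"
    using x by blast
  have "t *\<^sub>R y + (1 - t) *\<^sub>R 0 \<in> ?H"
    using t le by (intro convexD[OF convex_convex_hull]) (auto intro: hull_inc)
  then show ?thesis using t by simp
qed

theorem terminal_simplicial_singular_no_moderate_resolution:
  fixes N \<sigma> :: "'a::euclidean_space set"
  assumes N: "full_lattice N"
    and terminal: "toric_terminal N \<sigma>"
    and simplicial: "toric_Q_factorial N \<sigma>"
    and singular: "toric_singular N \<sigma>"
  shows "\<not> moderate_toric_resolution N \<sigma> \<Sigma>"
proof
  assume res: "moderate_toric_resolution N \<sigma> \<Sigma>"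
  then have \<sigma>: "nondegenerate_cone N \<sigma>" "subdivision N \<sigma> \<Sigma>"
    unfolding moderate_toric_resolution_def by auto
  then have rc: "rational_cone N \<sigma>" unfolding nondegenerate_cone_def by blast
  obtain \<tau> where \<tau>: "\<tau> \<in> \<Sigma>" "nondegenerate_cone N \<tau>" "\<tau> \<subseteq> \<sigma>"
    using subdivision_has_nondegenerate[OF \<sigma>] .
  have moderate: "smooth_cone N \<tau> \<and>
      (\<exists>l :: 'a \<Rightarrow> real. linear l \<and> (\<forall>u\<in>Gen N \<tau>. l u = 1) \<and>
        (\<forall>\<rho>\<in>rays \<sigma>. {x. l x = 1} \<inter> \<rho> \<noteq> {}))"
    using res \<tau>(1,2) unfolding moderate_toric_resolution_def by simp
  then have smooth: "smooth_cone N \<tau>" ..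
  obtain l :: "'a \<Rightarrow> real" where "linear l \<and> (\<forall>u\<in>Gen N \<tau>. l u = 1) \<and>
      (\<forall>\<rho>\<in>rays \<sigma>. {x. l x = 1} \<inter> \<rho> \<noteq> {})"
    using conjunct2[OF moderate] ..
  then have l: "linear l" "\<And>u. u \<in> Gen N \<tau> \<Longrightarrow> l u = 1"
    and meet: "\<And>\<rho>. \<rho> \<in> rays \<sigma> \<Longrightarrow> {x. l x = 1} \<inter> \<rho> \<noteq> {}"
    by simp_all
  have basis: "lattice_basis N (Gen N \<tau>)"
    using smooth_nondegenerate_lattice_basis[OF N \<tau>(2) smooth] .
  have ge: "l v \<ge> 1" if "v \<in> Gen N \<sigma>" for v
    using moderate_form_ge_1[OF rc l(1) linear_1_on_basis_integral[OF basis l] meet that] by blast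
  have sub: "Gen N \<tau> \<subseteq> Gen N \<sigma>"
  proof
    fix u assume u: "u \<in> Gen N \<tau>"
    then have "u \<in> convex_cone hull (Gen N \<sigma>)"
      using Gen_subset \<tau>(3) rational_cone_eq_hull_Gen[OF N rc] by blast
    then have "u \<in> convex hull (insert 0 (Gen N \<sigma>))"
      using ge l(2)[OF u] by (intro low_points_in_hull[OF l(1)]) simp_all
    moreover have "u \<in> N" "u \<noteq> 0" using u unfolding Gen_def primitive_def by auto
    ultimately show "u \<in> Gen N \<sigma>" using terminal unfolding toric_terminal_def by blast
  qed
  have "Gen N \<sigma> \<subseteq> Gen N \<tau>"
  proof
    fix v assume v: "v \<in> Gen N \<sigma>"
    show "v \<in> Gen N \<tau>"
    proof (rule ccontr)
      assume "v \<notin> Gen N \<tau>"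
      then have "span (Gen N \<tau>) \<subseteq> span (Gen N \<sigma> - {v})" using sub by (intro span_mono) blast
      then show False
        using nondegenerate_span_Gen[OF N \<tau>(2)] simplicial v
        unfolding toric_Q_factorial_def dependent_def by blast
    qed
  qed
  then have "smooth_cone N \<sigma>" using basis unfolding smooth_cone_def by blast
  then show False using singular unfolding toric_singular_def by blast
qed

theorem corollary1p8:
  fixes N \<sigma> :: "'a::euclidean_space set"
  assumes "full_lattice N"
    and "nondegenerate_cone N \<sigma>"
    and "(DIM('a) = 3 \<and> toric_terminal N \<sigma> \<and> toric_Q_factorial N \<sigma> \<and> toric_singular N \<sigma>) \<or>
         (DIM('a) = 4 \<and> toric_Gorenstein N \<sigma> \<and> toric_terminal N \<sigma> \<and> toric_Q_factorial N \<sigma> \<and>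
            toric_singular N \<sigma>)"
  shows "\<not> (\<exists>\<Sigma>. moderate_toric_resolution N \<sigma> \<Sigma>)"
  using assms(1,3) terminal_simplicial_singular_no_moderate_resolution by blast

end
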